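(* Let $G$ be a graph with at least one edge. Then (i) $\mathbb{E}\rho(G) < \max\rho(G) \le \mathrm{mr}(\mathbb{F}_2,G) \le \mathrm{nd}(G) < 2^{2\max\rho(G)+2} \le 2^{8\mathbb{E}\rho(G)+2}$; (ii) $\mathbb{E}\rho(G) < \mathrm{cd}(G) \le \tfrac{3}{2}\,\mathrm{mr}(\mathbb{F}_2,G) \le \tfrac{3}{2}\,\mathrm{nd}(G) \le \tfrac{3}{2}\, 2^{\mathrm{cd}(G)}$; (iii) $\mathrm{nd}(G) \le |\mathbb{F}|^{\mathrm{mr}(\mathbb{F},G)} \le |\mathbb{F}|^{\mathrm{nd}(G)}$ for every finite field $\mathbb{F}$.
   Context: All graphs are finite and simple. For a graph $G$ and $X\subseteq V(G)$, the cut-rank $\rho_G(X)$ is the rank over the binary field of the $X\times (V(G)\setminus X)$ matrix whose $(i,j)$-entry is $1$ iff $i$ is adjacent to $j$. The average cut-rank $\mathbb{E}\rho(G)=2^{-|V(G)|}\sum_{S\subseteq V(G)}\rho_G(S)$ (the expected cut-rank of a uniformly random subset). The maximum cut-rank is $\max\rho(G)=\max_{S\subseteq V(G)}\rho_G(S)$. Two distinct vertices $x,y$ are twins if $N(x)\setminus\{x,y\}=N(y)\setminus\{x,y\}$; the neighborhood diversity $\mathrm{nd}(G)$ is the number of classes of the equivalence relation on $V(G)$ where $x\sim y$ iff $x=y$ or $x,y$ are twins. For a field $\mathbb{F}$, $\mathrm{mr}(\mathbb{F},G)$ is the minimum rank of a symmetric $n\times n$ matrix $A=(a_{ij})$ over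 $\mathbb{F}$ ($n=|V(G)|$) such that for $i\ne j$, $a_{ij}\ne 0$ iff the $i$-th and $j$-th vertices are adjacent (diagonal entries arbitrary). $\mathbb{F}_2$ is the binary field. The clique delta-cover number $\mathrm{cd}(G)$ is the minimum $t$ such that there are complete graphs $G_1,\dots,G_t$ (on subsets of $V(G)$) with $E(G)=E(G_1)\triangle\cdots\triangle E(G_t)$. *)

theory Defs
  imports "HOL-Analysis.Analysis" "HOL-Library.Z2" "HOL-Library.Function_Algebras"
begin

definition complete_edges :: "'a set \<Rightarrow> 'a set set" where
  "complete_edges S = {e. e \<subseteq> S \<and> card e = 2}"

definition fin_simple_graph :: "'a set \<Rightarrow> 'a set set \<Rightarrow> bool" where
  "fin_simple_graph V E \<longleftrightarrow> finite V \<and> E \<subseteq> complete_edges V"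

text \<open>
  Matrices with rows and columns indexed by arbitrary sets are functions \<^typ>\<open>'a \<Rightarrow> 'b \<Rightarrow> 'f\<close>
  together with the two index sets; entries outside the index sets are ignored.  Rows live in
  the space of functions \<^typ>\<open>'b \<Rightarrow> 'f\<close> with pointwise operations, each row being extended
  by \<open>0\<close> outside the column index set.
\<close>

definition fun_scale :: "'f::field \<Rightarrow> ('b \<Rightarrow> 'f) \<Rightarrow> 'b \<Rightarrow> 'f" where
  "fun_scale c v = (\<lambda>j. c * v j)"

interpretation fun_vs: vector_space fun_scale
  by unfold_locales (auto simp: fun_scale_def fun_eq_iff algebra_simps)

definition rank_on :: "'a set \<Rightarrow> 'b set \<Rightarrow> ('a \<Rightarrow> 'b \<Rightarrow> 'f::field) \<Rightarrow> nat" where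
  "rank_on X Y M = fun_vs.dim ((\<lambda>i j. if j \<in> Y then M i j else 0) ` X)"

text \<open>On matrices indexed by finite types, this is the rank of HOL-Analysis.\<close>

lemma rank_on_UNIV: "rank_on UNIV UNIV (\<lambda>i j. A $ i $ j) = rank (A :: 'f::field ^ 'n ^ 'm)"
proof -
  interpret p: finite_dimensional_vector_space_pair_1 "(*s) :: 'f \<Rightarrow> 'f ^ 'n \<Rightarrow> 'f ^ 'n"
    cart_basis "fun_scale :: 'f \<Rightarrow> ('n \<Rightarrow> 'f) \<Rightarrow> 'n \<Rightarrow> 'f" ..
  have "Vector_Spaces.linear (*s) fun_scale (($) :: 'f ^ 'n \<Rightarrow> 'n \<Rightarrow> 'f)"
    by unfold_locales (auto simp: fun_scale_def fun_eq_iff)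
  moreover have "inj_on (($) :: 'f ^ 'n \<Rightarrow> 'n \<Rightarrow> 'f) S" for S
    by (simp add: inj_on_def vec_eq_iff)
  ultimately have "fun_vs.dim (($) ` rows A) = vec.dim (rows A)"
    by (rule p.dim_image_eq)
  moreover have "(\<lambda>i j. if j \<in> UNIV then A $ i $ j else 0) ` UNIV = ($) ` rows A"
    by (auto simp: rows_def row_def image_iff fun_eq_iff)
  ultimately show ?thesis
    by (simp add: rank_on_def row_rank_def_gen)
qed

text \<open>The type \<^typ>\<open>bit\<close> is the binary field.\<close>

definition cut_rank :: "'a set \<Rightarrow> 'a set set \<Rightarrow> 'a set \<Rightarrow> nat" where
  "cut_rank V E X = rank_on X (V - X) (\<lambda>i j. of_bool ({i, j} \<in> E) :: bit)"

definition avg_cut_rank :: "'a set \<Rightarrow> 'a set set \<Rightarrow> real" where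
  "avg_cut_rank V E = (\<Sum>S\<in>Pow V. real (cut_rank V E S)) / 2 ^ card V"

definition max_cut_rank :: "'a set \<Rightarrow> 'a set set \<Rightarrow> nat" where
  "max_cut_rank V E = Max (cut_rank V E ` Pow V)"

definition neighbours :: "'a set set \<Rightarrow> 'a \<Rightarrow> 'a set" where
  "neighbours E x = {y. {x, y} \<in> E}"

definition twins :: "'a set set \<Rightarrow> 'a \<Rightarrow> 'a \<Rightarrow> bool" where
  "twins E x y \<longleftrightarrow> x \<noteq> y \<and> neighbours E x - {x, y} = neighbours E y - {x, y}"

definition twin_rel :: "'a set \<Rightarrow> 'a set set \<Rightarrow> ('a \<times> 'a) set" where
  "twin_rel V E = {(x, y). x \<in> V \<and> y \<in> V \<and> (x = y \<or> twins E x y)}"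

definition nbhd_diversity :: "'a set \<Rightarrow> 'a set set \<Rightarrow> nat" where
  "nbhd_diversity V E = card (V // twin_rel V E)"

definition represents :: "'a set \<Rightarrow> 'a set set \<Rightarrow> ('a \<Rightarrow> 'a \<Rightarrow> 'f::field) \<Rightarrow> bool" where
  "represents V E A \<longleftrightarrow>
     (\<forall>i\<in>V. \<forall>j\<in>V. A i j = A j i) \<and>
     (\<forall>i\<in>V. \<forall>j\<in>V. i \<noteq> j \<longrightarrow> (A i j \<noteq> 0 \<longleftrightarrow> {i, j} \<in> E))"

definition min_rank :: "'f::field itself \<Rightarrow> 'a set \<Rightarrow> 'a set set \<Rightarrow> nat" where
  "min_rank _ V E = (LEAST r. \<exists>A :: 'a \<Rightarrow> 'a \<Rightarrow> 'f. represents V E A \<and> rank_on V V A = r)"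

definition clique_delta_cover :: "'a set \<Rightarrow> 'a set set \<Rightarrow> 'a set list \<Rightarrow> bool" where
  "clique_delta_cover V E Ks \<longleftrightarrow>
     (\<forall>K\<in>set Ks. K \<subseteq> V) \<and> E = foldr sym_diff (map complete_edges Ks) {}"

definition clique_delta_number :: "'a set \<Rightarrow> 'a set set \<Rightarrow> nat" where
  "clique_delta_number V E = (LEAST t. \<exists>Ks. clique_delta_cover V E Ks \<and> length Ks = t)"

end

(*
  All the cut-rank bounds come from factoring matrices through few rows. If X and Y are row bases
  of the two off-diagonal blocks of a cut of maximum rank, then maximality forces two vertices
  outside X Un Y with the same neighbours in X Un Y to be twins. The maximum cut-rank is at most
  four times the average because, for a maximum cut (S, T) and any W, the four sets W, W + T, W + S
  and W + V (symmetric differences) separate four blocks that together make up the S x T matrix.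
  A clique delta-cover is an expression of a symmetric binary matrix, up to its diagonal, as a
  sum of matrices u u^T, and symmetric elimination uses at most 3/2 such terms per unit of rank.
*)
theory Submission
  imports Defs
begin

section \<open>Rank of matrices over index sets\<close>

lemma sum_fun_app: "(\<Sum>i\<in>I. f i) x = (\<Sum>i\<in>I. f i x)"
  for f :: "'i \<Rightarrow> 'b \<Rightarrow> 'f::comm_monoid_add"
  by (induction I rule: infinite_finite_induct) auto

text \<open>The space of functions may be infinite-dimensional, so the exchange bound is applied to
  a finite basis chosen inside \<open>R\<close>.\<close>

lemma card_le_dim_of_independent:
  fixes R S :: "('b \<Rightarrow> 'f::field) set"
  assumes "finite R" "fun_vs.independent S" "S \<subseteq> fun_vs.span R"
  shows "card S \<le> fun_vs.dim R"
proof -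
  obtain B where B: "B \<subseteq> R" "R \<subseteq> fun_vs.span B" "card B = fun_vs.dim R"
    by (rule fun_vs.basis_exists)
  have "S \<subseteq> fun_vs.span B"
    using assms(3) B fun_vs.span_minimal[OF B(2)] by auto
  with fun_vs.independent_span_bound[OF finite_subset[OF B(1) assms(1)] assms(2)] B(3)
  show ?thesis by simp
qed

text \<open>Evaluation at \<open>p\<close> is a linear functional that kills the span of
  \<open>S\<close> but not \<open>w\<close>, so \<open>w\<close> extends a basis of \<open>S\<close>
  to a larger independent subset of the span of \<open>R\<close>.\<close>

lemma dim_less_of_vanishing:
  fixes R S :: "('b \<Rightarrow> 'f::field) set"
  assumes "finite R" "finite S" "S \<subseteq> fun_vs.span R"
    and w: "w \<in> fun_vs.span R" "w p \<noteq> 0" and S: "\<And>s. s \<in> S \<Longrightarrow> s p = 0"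
  shows "Suc (fun_vs.dim S) \<le> fun_vs.dim R"
proof -
  obtain B where B: "B \<subseteq> S" "fun_vs.independent B" "card B = fun_vs.dim S"
    by (rule fun_vs.basis_exists)
  have "v p = 0" if "v \<in> fun_vs.span B" for v
    using that
  proof (induction rule: fun_vs.span_induct_alt)
    case base then show ?case by simp
  next
    case (step c x y) then show ?case using S B(1) by (auto simp: fun_scale_def)
  qed
  hence "w \<notin> fun_vs.span B" using w by auto
  moreover from this have "w \<notin> B" using fun_vs.span_base[of w B] by auto
  ultimately have "fun_vs.independent (insert w B)"
    using B by (auto simp: fun_vs.independent_insert)
  hence "card (insert w B) \<le> fun_vs.dim R"
    using assms B by (intro card_le_dim_of_independent) auto
  moreover have "finite B" using B assms finite_subset by blast
  ultimately show ?thesis using \<open>w \<notin> B\<close> B(3) by simp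
qed

definition masked_row :: "'b set \<Rightarrow> ('a \<Rightarrow> 'b \<Rightarrow> 'f::zero) \<Rightarrow> 'a \<Rightarrow> 'b \<Rightarrow> 'f" where
  "masked_row Y M i = (\<lambda>j. if j \<in> Y then M i j else 0)"

lemma rank_on_masked: "rank_on X Y M = fun_vs.dim (masked_row Y M ` X)"
  by (simp add: rank_on_def masked_row_def[abs_def])

lemma span_masked_rows:
  fixes M :: "'a \<Rightarrow> 'b \<Rightarrow> 'f::field"
  assumes "finite X"
  shows "v \<in> fun_vs.span (masked_row Y M ` X) \<longleftrightarrow>
    (\<exists>a. v = (\<lambda>y. if y \<in> Y then \<Sum>x\<in>X. a x * M x y else 0))"
proof
  assume "v \<in> fun_vs.span (masked_row Y M ` X)"
  then show "\<exists>a. v = (\<lambda>y. if y \<in> Y then \<Sum>x\<in>X. a x * M x y else 0)"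
  proof (induction rule: fun_vs.span_induct_alt)
    case base
    show ?case by (rule exI[of _ "\<lambda>_. 0"]) auto
  next
    case (step c u v)
    then obtain x a where x: "x \<in> X" "u = masked_row Y M x"
      and a: "v = (\<lambda>y. if y \<in> Y then \<Sum>x\<in>X. a x * M x y else 0)" by auto
    have "(\<Sum>z\<in>X. (a z + (if z = x then c else 0)) * M z y) = c * M x y + (\<Sum>z\<in>X. a z * M z y)" for y
      using assms x(1)
      by (simp add: algebra_simps sum.distrib if_distrib[of "\<lambda>t. t * _"] if_distrib[of "\<lambda>t. _ * t"] cong: if_cong)
    then show ?case
      by (intro exI[of _ "\<lambda>z. a z + (if z = x then c else 0)"])
        (auto simp: x(2) a masked_row_def fun_scale_def)
  qed
next
  assume "\<exists>a. v = (\<lambda>y. if y \<in> Y then \<Sum>x\<in>X. a x * M x y else 0)"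
  then obtain a where a: "v = (\<lambda>y. if y \<in> Y then \<Sum>x\<in>X. a x * M x y else 0)" ..
  have "v = (\<Sum>x\<in>X. fun_scale (a x) (masked_row Y M x))"
    by (auto simp: a fun_eq_iff sum_fun_app fun_scale_def masked_row_def)
  then show "v \<in> fun_vs.span (masked_row Y M ` X)"
    by (simp add: fun_vs.span_sum fun_vs.span_scale fun_vs.span_base)
qed

lemma masked_row_in_span:
  fixes M N :: "_ \<Rightarrow> 'b \<Rightarrow> 'f::field"
  assumes "finite X"
  shows "masked_row Y N i \<in> fun_vs.span (masked_row Y M ` X) \<longleftrightarrow>
    (\<exists>a. \<forall>y\<in>Y. N i y = (\<Sum>x\<in>X. a x * M x y))"
  unfolding span_masked_rows[OF assms] by (auto simp: masked_row_def fun_eq_iff)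

text \<open>Upper bounds on rank come from factoring \<open>M\<close> through the rows of
  \<open>N\<close>. The row index type of \<open>N\<close> is free, so \<open>L\<close> may consist
  of twin classes or of positions in a list of cliques.\<close>

lemma rank_on_le_card:
  fixes M N :: "_ \<Rightarrow> 'b \<Rightarrow> 'f::field"
  assumes "finite L" and "\<And>i. i \<in> X \<Longrightarrow> \<exists>a. \<forall>y\<in>Y. M i y = (\<Sum>l\<in>L. a l * N l y)"
  shows "rank_on X Y M \<le> card L"
proof -
  have "fun_vs.dim (masked_row Y M ` X) \<le> card (masked_row Y N ` L)"
    using assms by (intro fun_vs.dim_le_card) (auto simp: masked_row_in_span)
  also have "\<dots> \<le> card L" using assms(1) by (rule card_image_le)
  finally show ?thesis by (simp add: rank_on_masked)
qed

text \<open>Independence of an indexed family rather than of a set of vectors: equal rows at two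
  different indices are dependent.\<close>

definition rows_indep :: "'a set \<Rightarrow> 'b set \<Rightarrow> ('a \<Rightarrow> 'b \<Rightarrow> 'f::field) \<Rightarrow> bool" where
  "rows_indep X Y M \<longleftrightarrow> (\<forall>c. (\<forall>y\<in>Y. (\<Sum>x\<in>X. c x * M x y) = 0) \<longrightarrow> (\<forall>x\<in>X. c x = 0))"

text \<open>One index is chosen for each vector of a basis of the row space, so
  \<open>masked_row Y M\<close> is injective on \<open>B\<close>, and relations between indices and
  between vectors correspond.\<close>

lemma rank_on_basis:
  fixes M :: "'a \<Rightarrow> 'b \<Rightarrow> 'f::field"
  assumes "finite X"
  obtains B where "B \<subseteq> X" "card B = rank_on X Y M" "rows_indep B Y M"
    "\<forall>i\<in>X. \<exists>a. \<forall>y\<in>Y. M i y = (\<Sum>x\<in>B. a x * M x y)"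
proof -
  let ?r = "masked_row Y M"
  obtain R where R: "R \<subseteq> ?r ` X" "fun_vs.independent R" "?r ` X \<subseteq> fun_vs.span R"
    "card R = fun_vs.dim (?r ` X)"
    by (rule fun_vs.basis_exists)
  obtain B where B: "B \<subseteq> X" "inj_on ?r B" "R = ?r ` B"
    using R(1) by (auto simp: subset_image_inj)
  have fin: "finite B" using B assms finite_subset by blast
  have indep: "rows_indep B Y M"
    unfolding rows_indep_def
  proof (intro allI impI ballI)
    fix c x assume c: "\<forall>y\<in>Y. (\<Sum>x\<in>B. c x * M x y) = 0" and x: "x \<in> B"
    let ?u = "\<lambda>v. c (the_inv_into B ?r v)"
    have "(\<Sum>v\<in>R. fun_scale (?u v) v) = (\<Sum>x\<in>B. fun_scale (c x) (?r x))"
      using B by (simp add: sum.reindex the_inv_into_f_f)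
    also have "\<dots> = 0"
    proof
      fix y show "(\<Sum>x\<in>B. fun_scale (c x) (?r x)) y = 0 y"
        using c by (cases "y \<in> Y") (auto simp: sum_fun_app fun_scale_def masked_row_def)
    qed
    finally have sum0: "(\<Sum>v\<in>R. fun_scale (?u v) v) = 0" .
    have "\<forall>v\<in>R. ?u v = 0"
    proof (rule ccontr)
      assume "\<not> (\<forall>v\<in>R. ?u v = 0)"
      with sum0 have "\<exists>u. (\<exists>v\<in>R. u v \<noteq> 0) \<and> (\<Sum>v\<in>R. fun_scale (u v) v) = 0"
        by (intro exI[of _ ?u]) auto
      then have "fun_vs.dependent R" using fin B(3) by (subst fun_vs.dependent_finite) auto
      with R(2) show False ..
    qed
    then show "c x = 0" using x B by (auto simp: the_inv_into_f_f)
  qed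
  have gen: "\<exists>a. \<forall>y\<in>Y. M i y = (\<Sum>x\<in>B. a x * M x y)" if "i \<in> X" for i
  proof -
    have "?r i \<in> fun_vs.span (?r ` B)" using R(3) that B(3) by auto
    then show ?thesis by (simp add: masked_row_in_span[OF fin])
  qed
  have "card B = rank_on X Y M"
    using B R(4) by (simp add: rank_on_masked card_image)
  with B(1) show ?thesis using indep ballI[OF gen] by (rule that)
qed

lemma rows_indep_independent:
  fixes M :: "'a \<Rightarrow> 'b \<Rightarrow> 'f::field"
  assumes "finite X" "rows_indep X Y M"
  shows "inj_on (masked_row Y M) X" "fun_vs.independent (masked_row Y M ` X)"
proof -
  let ?r = "masked_row Y M"
  have notin: "?r x \<notin> fun_vs.span (?r ` (X - {x}))" if x: "x \<in> X" for x
  proof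
    assume "?r x \<in> fun_vs.span (?r ` (X - {x}))"
    then obtain a where a: "\<forall>y\<in>Y. M x y = (\<Sum>z\<in>X - {x}. a z * M z y)"
      using assms(1) by (auto simp: masked_row_in_span)
    \<comment> \<open>Moving row \<open>x\<close> to the other side of its expression by the other
      rows gives a relation whose coefficient at \<open>x\<close> is \<open>-1\<close>.\<close>
    have "(\<Sum>z\<in>X. (a(x := -1)) z * M z y) = 0" if "y \<in> Y" for y
      using a that x assms(1) by (simp add: sum.remove[of X x])
    with assms(2) x have "(a(x := -1)) x = 0" unfolding rows_indep_def by blast
    then show False by simp
  qed
  show "inj_on ?r X"
  proof (rule inj_onI, rule ccontr)
    fix x y assume "x \<in> X" "y \<in> X" "?r x = ?r y" "x \<noteq> y"
    then have "?r x \<in> ?r ` (X - {x})" by (intro image_eqI[of _ _ y]) auto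
    then show False using notin[OF \<open>x \<in> X\<close>] by (simp add: fun_vs.span_base)
  qed
  show "fun_vs.independent (?r ` X)"
    unfolding fun_vs.dependent_def
  proof safe
    fix x assume "x \<in> X" "?r x \<in> fun_vs.span (?r ` X - {?r x})"
    moreover have "?r ` X - {?r x} \<subseteq> ?r ` (X - {x})" by auto
    ultimately show False using notin[OF \<open>x \<in> X\<close>] fun_vs.span_mono[THEN subsetD] by metis
  qed
qed

text \<open>A row outside the span of the rows of \<open>B\<close> would extend them to
  \<open>card B + 1\<close> independent rows, more than the rank allows.\<close>

lemma row_combination_of_indep_rows:
  fixes M :: "'a \<Rightarrow> 'b \<Rightarrow> 'f::field"
  assumes "finite X" "B \<subseteq> X" "rows_indep B Y M" "rank_on X Y M \<le> card B" "i \<in> X"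
  shows "\<exists>a. \<forall>y\<in>Y. M i y = (\<Sum>x\<in>B. a x * M x y)"
proof (rule ccontr)
  let ?r = "masked_row Y M"
  assume neg: "\<not> ?thesis"
  have fin: "finite B" using assms finite_subset by blast
  have notin: "?r i \<notin> fun_vs.span (?r ` B)"
    using neg by (simp add: masked_row_in_span[OF fin])
  note ind = rows_indep_independent[OF fin assms(3)]
  have "fun_vs.independent (insert (?r i) (?r ` B))"
    using notin ind(2) by (rule fun_vs.independent_insertI)
  moreover have "insert (?r i) (?r ` B) \<subseteq> fun_vs.span (?r ` X)"
    using assms(2,5) by (auto intro: fun_vs.span_base)
  ultimately have "card (insert (?r i) (?r ` B)) \<le> fun_vs.dim (?r ` X)"
    using assms(1) by (intro card_le_dim_of_independent) auto
  moreover have "?r i \<notin> ?r ` B" using notin fun_vs.span_base[of "?r i" "?r ` B"] by auto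
  ultimately show False
    using assms(4) fin ind by (simp add: rank_on_masked card_image)
qed

section \<open>Submatrices and block decompositions\<close>

lemma rank_on_mono:
  fixes M N :: "'a \<Rightarrow> 'b \<Rightarrow> 'f::field"
  assumes "finite X'" "X \<subseteq> X'" "Y \<subseteq> Y'" and "\<And>i j. i \<in> X \<Longrightarrow> j \<in> Y \<Longrightarrow> M i j = N i j"
  shows "rank_on X Y M \<le> rank_on X' Y' N"
proof -
  obtain B where B: "B \<subseteq> X'" "card B = rank_on X' Y' N" "rows_indep B Y' N"
    "\<forall>i\<in>X'. \<exists>a. \<forall>y\<in>Y'. N i y = (\<Sum>x\<in>B. a x * N x y)"
    by (rule rank_on_basis[OF assms(1), of Y' N])
  have "\<exists>a. \<forall>y\<in>Y. M i y = (\<Sum>x\<in>B. a x * N x y)" if i: "i \<in> X" for i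
  proof -
    obtain a where "\<forall>y\<in>Y'. N i y = (\<Sum>x\<in>B. a x * N x y)"
      using bspec[OF B(4) subsetD[OF assms(2) i]] by (rule exE)
    then show ?thesis using i assms(3,4) by (intro exI[of _ a]) auto
  qed
  then have "rank_on X Y M \<le> card B"
    using B(1) assms(1) by (intro rank_on_le_card[where N = N]) (auto intro: finite_subset)
  with B(2) show ?thesis by simp
qed

lemma rank_on_Un_rows:
  fixes M :: "'a \<Rightarrow> 'b \<Rightarrow> 'f::field"
  assumes "finite X" "finite X'"
  shows "rank_on (X \<union> X') Y M \<le> rank_on X Y M + rank_on X' Y M"
proof -
  let ?r = "masked_row Y M"
  obtain B where B: "B \<subseteq> ?r ` X" "?r ` X \<subseteq> fun_vs.span B" "card B = fun_vs.dim (?r ` X)"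
    by (rule fun_vs.basis_exists)
  obtain C where C: "C \<subseteq> ?r ` X'" "?r ` X' \<subseteq> fun_vs.span C" "card C = fun_vs.dim (?r ` X')"
    by (rule fun_vs.basis_exists)
  have "fun_vs.dim (?r ` (X \<union> X')) \<le> card (B \<union> C)"
  proof (rule fun_vs.dim_le_card)
    show "finite (B \<union> C)" using assms B(1) C(1) finite_subset by blast
    show "?r ` (X \<union> X') \<subseteq> fun_vs.span (B \<union> C)"
      using B(2) C(2) fun_vs.span_mono[of B "B \<union> C"] fun_vs.span_mono[of C "B \<union> C"] by blast
  qed
  also have "\<dots> \<le> card B + card C" by (rule card_Un_le)
  finally show ?thesis using B(3) C(3) by (simp add: rank_on_masked)
qed

lemma rank_on_Un_cols:
  fixes M :: "'a \<Rightarrow> 'b \<Rightarrow> 'f::field"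
  assumes "finite X"
  shows "rank_on X (Y \<union> Y') M \<le> rank_on X Y M + rank_on X Y' M"
proof -
  \<comment> \<open>The second block is cut down to \<open>Y' - Y\<close>, since otherwise the
    columns common to both blocks would be counted twice in the sum of the masked rows.\<close>
  let ?r = "masked_row Y M" and ?s = "masked_row (Y' - Y) M"
  obtain B where B: "B \<subseteq> ?r ` X" "?r ` X \<subseteq> fun_vs.span B" "card B = fun_vs.dim (?r ` X)"
    by (rule fun_vs.basis_exists)
  obtain C where C: "C \<subseteq> ?s ` X" "?s ` X \<subseteq> fun_vs.span C" "card C = fun_vs.dim (?s ` X)"
    by (rule fun_vs.basis_exists)
  have "fun_vs.dim (masked_row (Y \<union> Y') M ` X) \<le> card (B \<union> C)"
  proof (rule fun_vs.dim_le_card)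
    show "finite (B \<union> C)" using assms B(1) C(1) finite_subset by blast
    show "masked_row (Y \<union> Y') M ` X \<subseteq> fun_vs.span (B \<union> C)"
    proof safe
      fix x assume "x \<in> X"
      then have "?r x + ?s x \<in> fun_vs.span (B \<union> C)"
        using B(2) C(2) fun_vs.span_mono[of B "B \<union> C"] fun_vs.span_mono[of C "B \<union> C"]
        by (intro fun_vs.span_add) blast+
      moreover have "masked_row (Y \<union> Y') M x = ?r x + ?s x"
        by (auto simp: masked_row_def fun_eq_iff)
      ultimately show "masked_row (Y \<union> Y') M x \<in> fun_vs.span (B \<union> C)" by simp
    qed
  qed
  also have "\<dots> \<le> card B + card C" by (rule card_Un_le)
  also have "\<dots> = rank_on X Y M + rank_on X (Y' - Y) M" using B(3) C(3) by (simp add: rank_on_masked)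
  also have "rank_on X (Y' - Y) M \<le> rank_on X Y' M"
    using assms by (intro rank_on_mono) auto
  finally show ?thesis by (simp add: rank_on_masked)
qed

section \<open>Twins and minimum rank\<close>

lemma edgeD:
  assumes "fin_simple_graph V E" "{x, y} \<in> E"
  shows "x \<in> V" "y \<in> V" "x \<noteq> y"
  using assms by (auto simp: fin_simple_graph_def complete_edges_def card_insert_if)

lemma twins_iff:
  "twins E x y \<longleftrightarrow> x \<noteq> y \<and> (\<forall>z. z \<noteq> x \<longrightarrow> z \<noteq> y \<longrightarrow> ({x, z} \<in> E \<longleftrightarrow> {y, z} \<in> E))"
  by (auto simp: twins_def neighbours_def set_eq_iff)

lemma twins_trans:
  assumes "twins E x y" "twins E y z" "x \<noteq> z"
  shows "twins E x z"
  unfolding twins_iff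
proof (intro conjI allI impI)
  fix w assume w: "w \<noteq> x" "w \<noteq> z"
  have 1: "{x, u} \<in> E \<longleftrightarrow> {y, u} \<in> E" if "u \<noteq> x" "u \<noteq> y" for u
    using assms(1) that by (simp add: twins_iff)
  have 2: "{y, u} \<in> E \<longleftrightarrow> {z, u} \<in> E" if "u \<noteq> y" "u \<noteq> z" for u
    using assms(2) that by (simp add: twins_iff)
  show "{x, w} \<in> E \<longleftrightarrow> {z, w} \<in> E"
  \<comment> \<open>At \<open>w = y\<close> neither hypothesis applies to \<open>w\<close>; instead
    \<open>{x, y}\<close> and \<open>{z, y}\<close> are both compared with
    \<open>{x, z}\<close>.\<close>
  proof (cases "w = y")
    case True
    then show ?thesis
      using 1[of z] 2[of x] assms w by (auto simp: insert_commute twins_iff)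
  qed (use 1 2 w in auto)
qed fact

lemma equiv_twin_rel: "equiv V (twin_rel V E)"
proof (rule equivI)
  show "twin_rel V E \<subseteq> V \<times> V" by (auto simp: twin_rel_def)
  show "refl_on V (twin_rel V E)" by (auto simp: twin_rel_def refl_on_def)
  show "sym (twin_rel V E)" by (auto simp: twin_rel_def sym_def twins_iff)
  show "trans (twin_rel V E)"
    by (auto simp: twin_rel_def trans_def intro: twins_trans)
qed

text \<open>Any labelling of the vertices whose equal values force twins will do: a class is
  recovered from the label of any of its members. The upper bounds on neighbourhood diversity below
  all use such a labelling.\<close>

lemma nbhd_diversity_le_card_image:
  assumes "finite V" "\<And>x y. x \<in> V \<Longrightarrow> y \<in> V \<Longrightarrow> f x = f y \<Longrightarrow> x \<noteq> y \<Longrightarrow> twins E x y"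
  shows "nbhd_diversity V E \<le> card (f ` V)"
proof -
  let ?r = "twin_rel V E" and ?g = "inv_into V f"
  have "V // ?r \<subseteq> (\<lambda>t. ?r `` {?g t}) ` (f ` V)"
  proof
    fix C assume "C \<in> V // ?r"
    then obtain x where x: "x \<in> V" "C = ?r `` {x}" by (auto simp: quotient_def)
    have "?g (f x) \<in> V" "f (?g (f x)) = f x"
      using x(1) by (auto intro: inv_into_into f_inv_into_f)
    then have "(x, ?g (f x)) \<in> ?r"
      using assms(2)[of x "?g (f x)"] x(1) by (auto simp: twin_rel_def)
    then have "C = ?r `` {?g (f x)}"
      unfolding x(2) by (rule equiv_class_eq[OF equiv_twin_rel])
    then show "C \<in> (\<lambda>t. ?r `` {?g t}) ` (f ` V)"
      using x(1) by (intro image_eqI[of _ _ "f x"]) auto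
  qed
  then have "card (V // ?r) \<le> card ((\<lambda>t. ?r `` {?g t}) ` (f ` V))"
    using assms(1) by (intro card_mono) auto
  also have "\<dots> \<le> card (f ` V)" using assms(1) by (intro card_image_le) auto
  finally show ?thesis by (simp add: nbhd_diversity_def)
qed

text \<open>A vertex gets a nonzero diagonal entry iff it has an adjacent twin, so that twins have
  equal rows.\<close>

definition twin_matrix :: "'a set set \<Rightarrow> 'a \<Rightarrow> 'a \<Rightarrow> 'f::field" where
  "twin_matrix E i j =
     of_bool (if i = j then \<exists>k. twins E i k \<and> {i, k} \<in> E else {i, j} \<in> E)"

lemma represents_twin_matrix: "represents V E (twin_matrix E)"
  by (auto simp: represents_def twin_matrix_def insert_commute)

lemma twin_matrix_twins:
  assumes "twins E x y"
  shows "twin_matrix E x z = twin_matrix E y z"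
proof -
  \<comment> \<open>A twin class is a clique or edgeless, so a single twin \<open>v\<close> of
    \<open>u\<close> decides whether \<open>u\<close> has an adjacent twin.\<close>
  have diag: "(\<exists>k. twins E u k \<and> {u, k} \<in> E) \<longleftrightarrow> {v, u} \<in> E" if uv: "twins E u v" for u v
  proof
    assume "\<exists>k. twins E u k \<and> {u, k} \<in> E"
    then obtain k where "twins E u k" "{u, k} \<in> E" by blast
    with uv show "{v, u} \<in> E"
      unfolding twins_iff by (metis insert_commute)
  qed (use uv in \<open>auto simp: insert_commute\<close>)
  have sym: "twins E y x" using assms by (auto simp: twins_iff)
  from assms have ne: "x \<noteq> y" by (simp add: twins_iff)
  consider "z = x" | "z = y" | "z \<noteq> x" "z \<noteq> y" by blast
  then show ?thesis
  proof cases
    case 1 then show ?thesis using diag[OF assms] ne by (simp add: twin_matrix_def)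
  next
    case 2 then show ?thesis using diag[OF sym] ne by (simp add: twin_matrix_def)
  next
    case 3 then show ?thesis using assms by (auto simp: twin_matrix_def twins_iff)
  qed
qed

text \<open>Rows of twins coincide, so every row equals the row of a chosen representative of its
  class.\<close>

lemma rank_twin_matrix:
  assumes "finite V"
  shows "rank_on V V (twin_matrix E :: 'a \<Rightarrow> 'a \<Rightarrow> 'f::field) \<le> nbhd_diversity V E"
proof -
  let ?A = "twin_matrix E :: 'a \<Rightarrow> 'a \<Rightarrow> 'f" and ?r = "twin_rel V E"
  have fin: "finite (V // ?r)" using assms by (rule finite_quotient) (auto simp: twin_rel_def)
  have rep: "\<exists>C\<in>V // ?r. \<forall>y. ?A i y = ?A (SOME x. x \<in> C) y" if "i \<in> V" for i
  proof
    show "?r `` {i} \<in> V // ?r" using that by (rule quotientI)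
    have "i \<in> ?r `` {i}" using that by (auto simp: twin_rel_def)
    then have "(SOME x. x \<in> ?r `` {i}) \<in> ?r `` {i}" by (rule someI)
    then have "(i, SOME x. x \<in> ?r `` {i}) \<in> ?r" by (simp only: Image_singleton_iff)
    then have "i = (SOME x. x \<in> ?r `` {i}) \<or> twins E i (SOME x. x \<in> ?r `` {i})"
      by (simp only: twin_rel_def mem_Collect_eq prod.case)
    then show "\<forall>y. ?A i y = ?A (SOME x. x \<in> ?r `` {i}) y"
      using twin_matrix_twins[of E i "SOME x. x \<in> ?r `` {i}"] by metis
  qed
  have "rank_on V V ?A \<le> card (V // ?r)"
  proof (rule rank_on_le_card[OF fin])
    fix i assume "i \<in> V"
    from rep[OF this] obtain C where C: "C \<in> V // ?r" "\<forall>y. ?A i y = ?A (SOME x. x \<in> C) y" ..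
    show "\<exists>a. \<forall>y\<in>V. ?A i y = (\<Sum>C\<in>V // ?r. a C * ?A (SOME x. x \<in> C) y)"
    proof (intro exI ballI)
      fix y
      have "(\<Sum>D\<in>V // ?r. (if D = C then 1 else 0) * ?A (SOME x. x \<in> D) y) = ?A (SOME x. x \<in> C) y"
        using C(1) fin by (simp add: if_distrib[of "\<lambda>t. t * _"] cong: if_cong)
      then show "?A i y = (\<Sum>D\<in>V // ?r. (if D = C then 1 else 0) * ?A (SOME x. x \<in> D) y)"
        using C(2) by simp
    qed
  qed
  then show ?thesis by (simp add: nbhd_diversity_def)
qed

section \<open>Minimum rank over a field\<close>

lemma min_rank_attained:
  obtains A :: "'a \<Rightarrow> 'a \<Rightarrow> 'f::field"
  where "represents V E A" "rank_on V V A = min_rank TYPE('f) V E"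
proof -
  \<comment> \<open>The twin matrix shows that the minimum is taken over a nonempty set, so
    \<open>LEAST\<close> is attained.\<close>
  have "\<exists>r. \<exists>A :: 'a \<Rightarrow> 'a \<Rightarrow> 'f. represents V E A \<and> rank_on V V A = r"
    using represents_twin_matrix by blast
  from LeastI_ex[OF this] that show ?thesis unfolding min_rank_def by blast
qed

lemma min_rank_le_rank:
  fixes A :: "'a \<Rightarrow> 'a \<Rightarrow> 'f::field"
  shows "represents V E A \<Longrightarrow> min_rank TYPE('f) V E \<le> rank_on V V A"
  unfolding min_rank_def by (rule Least_le) blast

lemma min_rank_le_nbhd_diversity:
  "finite V \<Longrightarrow> min_rank TYPE('f::field) V E \<le> nbhd_diversity V E"
  using min_rank_le_rank[OF represents_twin_matrix] rank_twin_matrix by (rule order_trans)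

lemma card_span_le:
  fixes B :: "('b \<Rightarrow> 'f::{field,finite}) set"
  assumes "finite B"
  shows "finite (fun_vs.span B) \<and> card (fun_vs.span B) \<le> CARD('f) ^ card B"
proof -
  let ?c = "\<lambda>u. \<Sum>v\<in>B. fun_scale (u v) v" and ?P = "B \<rightarrow>\<^sub>E (UNIV :: 'f set)"
  have "fun_vs.span B \<subseteq> ?c ` ?P"
  proof
    fix w assume "w \<in> fun_vs.span B"
    then obtain u where "w = ?c u" by (auto simp: fun_vs.span_finite[OF assms])
    \<comment> \<open>Restricting the coefficients to \<open>B\<close> puts them among the
      extensional functions \<open>?P\<close>, of which there are
      \<open>CARD('f) ^ card B\<close>.\<close>
    then have w: "w = ?c (restrict u B)" by simp
    show "w \<in> ?c ` ?P" unfolding w by (rule imageI) auto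
  qed
  moreover have "finite ?P" using assms by (intro finite_PiE) auto
  ultimately have "finite (fun_vs.span B)" "card (fun_vs.span B) \<le> card ?P"
    by (auto intro: finite_subset surj_card_le)
  then show ?thesis using assms by (simp add: card_PiE)
qed

text \<open>Two vertices with equal rows in a representing matrix are twins, and the number of
  vectors in the row space is at most \<open>CARD('f)\<close> to the power of the rank.\<close>

lemma nbhd_diversity_le_power_min_rank:
  assumes G: "fin_simple_graph V E"
  shows "nbhd_diversity V E \<le> CARD('f::{field,finite}) ^ min_rank TYPE('f) V E"
proof -
  obtain A :: "'a \<Rightarrow> 'a \<Rightarrow> 'f"
    where A: "represents V E A" "rank_on V V A = min_rank TYPE('f) V E"
    by (rule min_rank_attained)
  let ?r = "masked_row V A"
  have fin: "finite V" using G by (simp add: fin_simple_graph_def)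
  obtain B where B: "B \<subseteq> ?r ` V" "?r ` V \<subseteq> fun_vs.span B" "card B = fun_vs.dim (?r ` V)"
    by (rule fun_vs.basis_exists)
  have finB: "finite B" using B(1) fin finite_subset by blast
  have "nbhd_diversity V E \<le> card (?r ` V)"
  proof (rule nbhd_diversity_le_card_image[OF fin])
    fix x y assume xy: "x \<in> V" "y \<in> V" "?r x = ?r y" "x \<noteq> y"
    have "{x, z} \<in> E \<longleftrightarrow> {y, z} \<in> E" if "z \<noteq> x" "z \<noteq> y" for z
    proof (cases "z \<in> V")
      case True
      then have "A x z = A y z" using fun_cong[OF xy(3), of z] by (simp add: masked_row_def)
      then show ?thesis using A(1) True that xy unfolding represents_def by metis
    next
      \<comment> \<open>\<open>twins\<close> compares adjacency to every element of the vertex type;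
        those outside \<open>V\<close> have no edges.\<close>
      case False
      then show ?thesis using edgeD(2)[OF G] by blast
    qed
    then show "twins E x y" using xy(4) by (simp add: twins_iff)
  qed
  also have "\<dots> \<le> card (fun_vs.span B)"
    using B(2) card_span_le[OF finB] by (intro card_mono) auto
  also have "\<dots> \<le> CARD('f) ^ card B" using card_span_le[OF finB] by simp
  finally show ?thesis using A(2) B(3) by (simp add: rank_on_masked)
qed

section \<open>Maximum cut-rank\<close>

lemma max_cut_rank_attained:
  assumes "finite V"
  obtains S where "S \<subseteq> V" "cut_rank V E S = max_cut_rank V E"
proof -
  have "max_cut_rank V E \<in> cut_rank V E ` Pow V"
    unfolding max_cut_rank_def using assms by (intro Max_in) auto
  then show ?thesis using that by auto
qed

lemma cut_rank_le_max: "finite V \<Longrightarrow> S \<subseteq> V \<Longrightarrow> cut_rank V E S \<le> max_cut_rank V E"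
  unfolding max_cut_rank_def by (intro Max_ge) auto

lemma max_cut_rank_le:
  "finite V \<Longrightarrow> (\<And>S. S \<subseteq> V \<Longrightarrow> cut_rank V E S \<le> n) \<Longrightarrow> max_cut_rank V E \<le> n"
  unfolding max_cut_rank_def by (intro Max.boundedI) auto

text \<open>The block between \<open>S\<close> and \<open>V - S\<close> avoids the diagonal, and a
  nonzero entry over \<open>bit\<close> is \<open>1\<close>; so every representing matrix contains
  the cut matrix as a submatrix.\<close>

lemma max_cut_rank_le_min_rank:
  assumes "finite V"
  shows "max_cut_rank V E \<le> min_rank TYPE(bit) V E"
proof (rule max_cut_rank_le[OF assms])
  fix S assume "S \<subseteq> V"
  obtain A :: "'a \<Rightarrow> 'a \<Rightarrow> bit"
    where A: "represents V E A" "rank_on V V A = min_rank TYPE(bit) V E"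
    by (rule min_rank_attained)
  have "cut_rank V E S \<le> rank_on V V A"
    unfolding cut_rank_def
  proof (rule rank_on_mono[OF assms])
    fix i j assume "i \<in> S" "j \<in> V - S"
    then have "i \<in> V" "j \<in> V" "i \<noteq> j" using \<open>S \<subseteq> V\<close> by auto
    then have "A i j = 1 \<longleftrightarrow> {i, j} \<in> E"
      using A(1) by (auto simp: represents_def)
    then show "of_bool ({i, j} \<in> E) = A i j" by (cases "A i j") auto
  qed (use \<open>S \<subseteq> V\<close> in auto)
  with A(2) show "cut_rank V E S \<le> min_rank TYPE(bit) V E" by simp
qed

lemma cut_rank_empty: "cut_rank V E {} = 0"
  using rank_on_le_card[of "{}" "{}" "V - {}" "\<lambda>i j. of_bool ({i, j} \<in> E) :: bit"]
  by (simp add: cut_rank_def)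

lemma max_cut_rank_pos:
  assumes G: "fin_simple_graph V E" and "E \<noteq> {}"
  shows "0 < max_cut_rank V E"
proof -
  obtain x y where xy: "{x, y} \<in> E"
    using assms by (auto simp: fin_simple_graph_def complete_edges_def card_2_iff) blast
  note V = edgeD[OF G xy]
  have fin: "finite V" using G by (simp add: fin_simple_graph_def)
  obtain B where B: "B \<subseteq> {x}" "card B = cut_rank V E {x}"
    "rows_indep B (V - {x}) (\<lambda>i j. of_bool ({i, j} \<in> E) :: bit)"
    "\<forall>i\<in>{x}. \<exists>a. \<forall>j\<in>V - {x}. (of_bool ({i, j} \<in> E) :: bit) = (\<Sum>k\<in>B. a k * of_bool ({k, j} \<in> E))"
    unfolding cut_rank_def by (rule rank_on_basis[of "{x}" "V - {x}" "\<lambda>i j. of_bool ({i, j} \<in> E) :: bit"]) auto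
  have "B \<noteq> {}" using B(4) V xy by auto
  then have "0 < cut_rank V E {x}"
    using B(1,2) by (metis card_gt_0_iff finite.emptyI finite_insert finite_subset)
  also have "\<dots> \<le> max_cut_rank V E" using fin V by (intro cut_rank_le_max) auto
  finally show ?thesis .
qed

text \<open>The empty set has cut-rank zero, which is strictly below the maximum once there is an
  edge.\<close>

lemma avg_less_max:
  assumes G: "fin_simple_graph V E" and "E \<noteq> {}"
  shows "avg_cut_rank V E < real (max_cut_rank V E)"
proof -
  have fin: "finite V" using G by (simp add: fin_simple_graph_def)
  have "(\<Sum>S\<in>Pow V. real (cut_rank V E S)) < (\<Sum>S\<in>Pow V. real (max_cut_rank V E))"
  proof (rule sum_strict_mono_ex1)
    show "\<exists>S\<in>Pow V. real (cut_rank V E S) < real (max_cut_rank V E)"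
      using max_cut_rank_pos[OF assms] by (intro bexI[of _ "{}"]) (auto simp: cut_rank_empty)
  qed (use fin cut_rank_le_max[OF fin] in auto)
  then show ?thesis using fin by (simp add: avg_cut_rank_def card_Pow field_simps)
qed

text \<open>The rows \<open>X\<close> stay independent on the columns \<open>Y\<close>. In a cut
  with \<open>i\<close> and \<open>j\<close> on the side of \<open>X\<close>, maximality makes their
  rows combinations of the rows \<open>X\<close>, and the values on \<open>Y\<close> already fix the
  coefficients.\<close>

lemma twins_by_max_cut_basis:
  fixes V E defines "M \<equiv> \<lambda>i j. of_bool ({i, j} \<in> E) :: bit"
  assumes G: "fin_simple_graph V E" and S: "S \<subseteq> V"
    and X: "X \<subseteq> S" "rows_indep X (V - S) M" "max_cut_rank V E \<le> card X"
    and Y: "Y \<subseteq> V - S" "\<forall>t\<in>V - S. \<exists>a. \<forall>s\<in>S. M t s = (\<Sum>y\<in>Y. a y * M y s)"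
    and i: "i \<in> V - (X \<union> Y)" and j: "j \<in> V - (X \<union> Y)" and "i \<noteq> j"
    and eq: "\<And>z. z \<in> X \<union> Y \<Longrightarrow> {i, z} \<in> E \<longleftrightarrow> {j, z} \<in> E"
  shows "twins E i j"
proof -
  have fin: "finite V" using G by (simp add: fin_simple_graph_def)
  have finX: "finite X" using X(1) S fin by (meson finite_subset)
  have sym: "M x y = M y x" for x y by (simp add: M_def insert_commute)
  \<comment> \<open>By symmetry of \<open>M\<close>, the columns over \<open>V - S\<close> are
    combinations of the columns over \<open>Y\<close> on the rows in \<open>S\<close>, so a relation
    that holds on \<open>Y\<close> extends to \<open>V - S\<close>.\<close>
  have indep: "rows_indep X Y M"
    unfolding rows_indep_def
  proof (intro allI impI)
    fix c assume c: "\<forall>y\<in>Y. (\<Sum>x\<in>X. c x * M x y) = 0"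
    have "(\<Sum>x\<in>X. c x * M x t) = 0" if t: "t \<in> V - S" for t
    proof -
      obtain a where a: "\<forall>s\<in>S. M t s = (\<Sum>y\<in>Y. a y * M y s)" using bspec[OF Y(2) t] ..
      have "(\<Sum>x\<in>X. c x * M x t) = (\<Sum>x\<in>X. \<Sum>y\<in>Y. c x * (a y * M y x))"
      proof (rule sum.cong)
        fix x assume "x \<in> X"
        then have "M x t = (\<Sum>y\<in>Y. a y * M y x)" using a X(1) sym[of x t] by auto
        then show "c x * M x t = (\<Sum>y\<in>Y. c x * (a y * M y x))" by (simp only: sum_distrib_left)
      qed simp
      also have "\<dots> = (\<Sum>y\<in>Y. a y * (\<Sum>x\<in>X. c x * M x y))"
        by (subst sum.swap) (simp only: sum_distrib_left sym mult.left_commute)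
      also have "\<dots> = 0" using c by simp
      finally show ?thesis .
    qed
    with X(2) show "\<forall>x\<in>X. c x = 0" unfolding rows_indep_def by blast
  qed
  have "{i, k} \<in> E \<longleftrightarrow> {j, k} \<in> E" if k: "k \<noteq> i" "k \<noteq> j" for k
  proof -
    consider "k \<in> X \<union> Y" | "k \<notin> V" | "k \<in> V - (X \<union> Y)" by blast
    then show ?thesis
    proof cases
      case 1 then show ?thesis by (rule eq)
    next
      case 2 then show ?thesis using edgeD(2)[OF G] by blast
    next
      case 3
      \<comment> \<open>The new cut has \<open>i\<close> and \<open>j\<close> next to
        \<open>X\<close>, and \<open>Y\<close> and \<open>k\<close> opposite, whichever sides of the
        old cut \<open>i\<close>, \<open>j\<close> and \<open>k\<close> came from.\<close>
      let ?P = "X \<union> {i, j}"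
      have P: "?P \<subseteq> V" "Y \<subseteq> V - ?P" "k \<in> V - ?P"
        using X(1) Y(1) S i j k 3 by auto
      have "rows_indep X (V - ?P) M"
        using indep P(2) unfolding rows_indep_def by (meson subsetD)
      moreover have "rank_on ?P (V - ?P) M \<le> card X"
        using cut_rank_le_max[OF fin P(1), of E] X(3) by (simp add: cut_rank_def M_def)
      ultimately have comb: "\<exists>a. \<forall>y\<in>V - ?P. M u y = (\<Sum>x\<in>X. a x * M x y)" if "u \<in> ?P" for u
        using that finX by (intro row_combination_of_indep_rows[where X = ?P]) auto
      obtain a where a: "\<forall>y\<in>V - ?P. M i y = (\<Sum>x\<in>X. a x * M x y)" using comb[of i] by auto
      obtain b where b: "\<forall>y\<in>V - ?P. M j y = (\<Sum>x\<in>X. b x * M x y)" using comb[of j] by auto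
      \<comment> \<open>Since \<open>i\<close> and \<open>j\<close> agree on \<open>Y\<close>, the
        difference of their coefficient vectors is a relation among the rows \<open>X\<close> on
        \<open>Y\<close>.\<close>
      have "(\<Sum>x\<in>X. (a x - b x) * M x y) = 0" if y: "y \<in> Y" for y
      proof -
        have "y \<in> V - ?P" using P(2) y by blast
        then have "(\<Sum>x\<in>X. (a x - b x) * M x y) = M i y - M j y"
          using a b by (simp only: left_diff_distrib sum_subtractf)
        also have "\<dots> = 0" using eq[of y] y by (simp add: M_def)
        finally show ?thesis .
      qed
      then have "\<forall>x\<in>X. a x - b x = 0"
        by (intro spec[OF indep[unfolded rows_indep_def], of "\<lambda>x. a x - b x", THEN mp] ballI)
      then have ab: "\<forall>x\<in>X. a x = b x" using right_minus_eq by blast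
      have "M i k = (\<Sum>x\<in>X. a x * M x k)" using a P(3) by blast
      also have "\<dots> = (\<Sum>x\<in>X. b x * M x k)" using ab by (intro sum.cong) auto
      also have "\<dots> = M j k" using b P(3) by simp
      finally show ?thesis by (simp only: M_def of_bool_eq_iff)
    qed
  qed
  with \<open>i \<noteq> j\<close> show ?thesis by (simp add: twins_iff)
qed

lemma nbhd_diversity_less:
  assumes G: "fin_simple_graph V E"
  shows "nbhd_diversity V E < 2 ^ (2 * max_cut_rank V E + 2)"
proof -
  let ?M = "\<lambda>i j. of_bool ({i, j} \<in> E) :: bit" and ?r = "max_cut_rank V E"
  have fin: "finite V" using G by (simp add: fin_simple_graph_def)
  obtain S where S: "S \<subseteq> V" "cut_rank V E S = ?r"
    using max_cut_rank_attained[OF fin] .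
  have finS: "finite S" "finite (V - S)" using S fin finite_subset by auto
  obtain X where X: "X \<subseteq> S" "card X = rank_on S (V - S) ?M" "rows_indep X (V - S) ?M"
    by (rule rank_on_basis[OF finS(1), of "V - S" ?M])
  obtain Y where Y: "Y \<subseteq> V - S" "card Y = rank_on (V - S) S ?M"
    "rows_indep Y S ?M" "\<forall>t\<in>V - S. \<exists>a. \<forall>s\<in>S. ?M t s = (\<Sum>y\<in>Y. a y * ?M y s)"
    by (rule rank_on_basis[OF finS(2), of S ?M])
  have cX: "card X = ?r" using X(2) S(2) by (simp add: cut_rank_def)
  \<comment> \<open>The transposed block is the matrix of the cut at \<open>V - S\<close>, so its
    rank is bounded by the maximum without comparing row and column rank.\<close>
  have "V - (V - S) = S" using S(1) by auto
  then have cY: "card Y \<le> ?r"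
    using Y(2) cut_rank_le_max[OF fin, of "V - S" E] by (simp add: cut_rank_def)
  let ?Z = "X \<union> Y"
  have finZ: "finite ?Z" using X(1) Y(1) finS finite_subset by blast
  have cZ: "card ?Z \<le> 2 * ?r" using card_Un_le[of X Y] cX cY by simp
  \<comment> \<open>Vertices of \<open>?Z\<close> get labels of their own, because the twin
    criterion speaks only of vertices outside \<open>?Z\<close>.\<close>
  let ?f = "\<lambda>i. if i \<in> ?Z then Inl i else Inr (neighbours E i \<inter> ?Z)"
  have "nbhd_diversity V E \<le> card (?f ` V)"
  proof (rule nbhd_diversity_le_card_image[OF fin])
    fix i j assume ij: "i \<in> V" "j \<in> V" "?f i = ?f j" "i \<noteq> j"
    then have ijZ: "i \<in> V - ?Z" "j \<in> V - ?Z" by (auto split: if_splits)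
    then have "neighbours E i \<inter> ?Z = neighbours E j \<inter> ?Z" using ij(3) by simp
    then have "{i, z} \<in> E \<longleftrightarrow> {j, z} \<in> E" if "z \<in> ?Z" for z
      using that by (auto simp: neighbours_def set_eq_iff)
    then show "twins E i j"
      using ijZ ij(4) X(1,3) Y(1,4) cX by (intro twins_by_max_cut_basis[OF G S(1), of X Y]) auto
  qed
  also have "\<dots> \<le> card (?Z <+> Pow ?Z)"
    using finZ by (intro card_mono) auto
  also have "\<dots> = card ?Z + 2 ^ card ?Z"
    using finZ by (simp add: card_Plus card_Pow)
  \<comment> \<open>Strictness enters here, through \<open>n < 2 ^ n\<close> with
    \<open>n = card ?Z\<close>.\<close>
  also have "\<dots> < 2 ^ card ?Z + 2 ^ card ?Z" by (simp add: less_exp)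
  also have "\<dots> = 2 ^ (card ?Z + 1)" by simp
  also have "\<dots> \<le> 2 ^ (2 * ?r + 2)" using cZ by (intro power_increasing) auto
  finally show ?thesis .
qed

lemma max_cut_rank_le_four_avg:
  assumes "finite V"
  shows "real (max_cut_rank V E) \<le> 4 * avg_cut_rank V E"
proof -
  let ?M = "\<lambda>i j. of_bool ({i, j} \<in> E) :: bit" and ?r = "max_cut_rank V E"
    and ?\<rho> = "cut_rank V E"
  obtain S where S: "S \<subseteq> V" "?\<rho> S = ?r"
    using max_cut_rank_attained[OF assms] .
  define T where "T = V - S"
  have fin: "finite S" "finite T" using S(1) assms finite_subset by (auto simp: T_def)
  have le: "rank_on A B ?M \<le> ?\<rho> W" if "A \<subseteq> W" "B \<subseteq> V - W" "W \<subseteq> V" for A B W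
    unfolding cut_rank_def using that assms finite_subset by (intro rank_on_mono) auto
  have quad: "?r \<le> ?\<rho> W + ?\<rho> (sym_diff W T) + (?\<rho> (sym_diff W S) + ?\<rho> (sym_diff W V))"
    if W: "W \<subseteq> V" for W
  proof -
    \<comment> \<open>For instance \<open>sym_diff W T\<close> equals
      \<open>?A \<union> ?B'\<close>, with \<open>?A\<close> inside and \<open>?B\<close> outside;
      the other three cuts are read in the same way.\<close>
    let ?A = "W \<inter> S" and ?A' = "S - W" and ?B = "W \<inter> T" and ?B' = "T - W"
    have "?r = rank_on (?A \<union> ?A') T ?M"
      using S(2) by (simp add: cut_rank_def T_def Int_commute Int_Diff_Un)
    also have "\<dots> \<le> rank_on ?A (?B \<union> ?B') ?M + rank_on ?A' (?B \<union> ?B') ?M"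
      using fin rank_on_Un_rows[of ?A ?A' T ?M] by (simp add: Int_commute Int_Diff_Un)
    also have "rank_on ?A (?B \<union> ?B') ?M \<le> rank_on ?A ?B ?M + rank_on ?A ?B' ?M"
      using fin by (intro rank_on_Un_cols) auto
    also have "rank_on ?A' (?B \<union> ?B') ?M \<le> rank_on ?A' ?B ?M + rank_on ?A' ?B' ?M"
      using fin by (intro rank_on_Un_cols) auto
    also have "rank_on ?A ?B ?M \<le> ?\<rho> (sym_diff W T)"
      using W S(1) by (intro le) (auto simp: T_def)
    also have "rank_on ?A ?B' ?M \<le> ?\<rho> W"
      using W S(1) by (intro le) (auto simp: T_def)
    also have "rank_on ?A' ?B ?M \<le> ?\<rho> (sym_diff W V)"
      using W S(1) by (intro le) (auto simp: T_def)
    also have "rank_on ?A' ?B' ?M \<le> ?\<rho> (sym_diff W S)"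
      using W S(1) by (intro le) (auto simp: T_def)
    finally show ?thesis by simp
  qed
  \<comment> \<open>Symmetric difference with a fixed \<open>D\<close> is an involution of
    \<open>Pow V\<close>, so each of the four cuts runs over all subsets as \<open>W\<close>
    does.\<close>
  have inv: "(\<Sum>W\<in>Pow V. ?\<rho> (sym_diff W D)) = (\<Sum>W\<in>Pow V. ?\<rho> W)" if "D \<subseteq> V" for D
    using that
    by (intro sum.reindex_bij_witness[of _ "\<lambda>W. sym_diff W D" "\<lambda>W. sym_diff W D"]) auto
  have "2 ^ card V * ?r = (\<Sum>W\<in>Pow V. ?r)" using assms by (simp add: card_Pow)
  also have "\<dots> \<le> (\<Sum>W\<in>Pow V. ?\<rho> W + ?\<rho> (sym_diff W T) + (?\<rho> (sym_diff W S) + ?\<rho> (sym_diff W V)))"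
    using quad by (intro sum_mono) auto
  also have "\<dots> = 4 * (\<Sum>W\<in>Pow V. ?\<rho> W)"
    using S(1) by (simp only: sum.distrib inv T_def Diff_subset subset_refl)
  finally have "real (2 ^ card V * ?r) \<le> real (4 * (\<Sum>W\<in>Pow V. ?\<rho> W))"
    by (simp only: of_nat_le_iff)
  then show ?thesis by (simp add: avg_cut_rank_def field_simps)
qed

section \<open>Clique delta-covers\<close>

text \<open>Symmetric difference adds indicator functions modulo two. The case \<open>i = j\<close>
  is excluded because \<open>{i, i}\<close> is no edge, while the sum counts the cliques containing
  \<open>i\<close>.\<close>

lemma edge_clique_delta_cover_iff:
  assumes "i \<noteq> j"
  shows "(of_bool ({i, j} \<in> foldr sym_diff (map complete_edges Ks) {}) :: bit) =
    (\<Sum>K\<leftarrow>Ks. of_bool (i \<in> K) * of_bool (j \<in> K))"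
proof (induction Ks)
  case (Cons K Ks)
  have "{i, j} \<in> complete_edges K \<longleftrightarrow> i \<in> K \<and> j \<in> K"
    using assms by (auto simp: complete_edges_def)
  with Cons show ?case by (auto simp flip: Cons.IH)
qed simp

lemma foldr_sym_diff_complete_edges_subset:
  "\<forall>K\<in>set Ks. K \<subseteq> V \<Longrightarrow> foldr sym_diff (map complete_edges Ks) {} \<subseteq> complete_edges V"
  by (induction Ks) (auto simp: complete_edges_def)

lemma clique_delta_cover_iff:
  assumes "fin_simple_graph V E" "\<forall>K\<in>set Ks. K \<subseteq> V"
  shows "clique_delta_cover V E Ks \<longleftrightarrow>
    (\<forall>i\<in>V. \<forall>j\<in>V. i \<noteq> j \<longrightarrow>
      (of_bool ({i, j} \<in> E) :: bit) = (\<Sum>K\<leftarrow>Ks. of_bool (i \<in> K) * of_bool (j \<in> K)))"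
proof
  assume "clique_delta_cover V E Ks"
  then have E: "E = foldr sym_diff (map complete_edges Ks) {}"
    by (simp add: clique_delta_cover_def)
  show "\<forall>i\<in>V. \<forall>j\<in>V. i \<noteq> j \<longrightarrow>
      (of_bool ({i, j} \<in> E) :: bit) = (\<Sum>K\<leftarrow>Ks. of_bool (i \<in> K) * of_bool (j \<in> K))"
    unfolding E by (intro ballI impI edge_clique_delta_cover_iff)
next
  assume *: "\<forall>i\<in>V. \<forall>j\<in>V. i \<noteq> j \<longrightarrow>
      (of_bool ({i, j} \<in> E) :: bit) = (\<Sum>K\<leftarrow>Ks. of_bool (i \<in> K) * of_bool (j \<in> K))"
  let ?F = "foldr sym_diff (map complete_edges Ks) {}"
  \<comment> \<open>Both edge sets consist of pairs inside \<open>V\<close>, so it is enough to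
    compare them on such pairs.\<close>
  have "e \<in> E \<longleftrightarrow> e \<in> ?F" if e: "e \<in> complete_edges V" for e
  proof -
    obtain i j where ij: "e = {i, j}" "i \<noteq> j" "i \<in> V" "j \<in> V"
      using e by (auto simp: complete_edges_def card_2_iff)
    then have "(of_bool (e \<in> E) :: bit) = of_bool (e \<in> ?F)"
      using * edge_clique_delta_cover_iff[OF ij(2), of Ks] by simp
    then show ?thesis by (simp only: of_bool_eq_iff)
  qed
  moreover have "E \<subseteq> complete_edges V" using assms(1) by (simp add: fin_simple_graph_def)
  ultimately have "E = ?F"
    using foldr_sym_diff_complete_edges_subset[OF assms(2)] by (intro set_eqI) (meson subsetD)
  then show "clique_delta_cover V E Ks"
    using assms(2) by (simp add: clique_delta_cover_def)
qed

text \<open>Adding multiples of row \<open>p\<close> keeps every row in the old row space, but all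
  new rows vanish in column \<open>c\<close>, where row \<open>p\<close> of \<open>A\<close> does
  not; so the dimension drops.\<close>

lemma rank_on_eliminate:
  fixes A B :: "'a \<Rightarrow> 'b \<Rightarrow> 'f::field"
  assumes fin: "finite V" and p: "p \<in> V" and c: "c \<in> W" "A p c \<noteq> 0"
    and B: "\<And>i j. i \<in> V \<Longrightarrow> j \<in> W \<Longrightarrow> B i j = A i j + f i * A p j" "\<And>i. i \<in> V \<Longrightarrow> B i c = 0"
  shows "Suc (rank_on V W B) \<le> rank_on V W A"
  unfolding rank_on_masked
proof (rule dim_less_of_vanishing)
  show "masked_row W A p \<in> fun_vs.span (masked_row W A ` V)"
    using p by (auto intro: fun_vs.span_base)
  show "masked_row W B ` V \<subseteq> fun_vs.span (masked_row W A ` V)"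
  proof safe
    fix i assume i: "i \<in> V"
    have "masked_row W A i + fun_scale (f i) (masked_row W A p) \<in> fun_vs.span (masked_row W A ` V)"
      using i p by (intro fun_vs.span_add fun_vs.span_scale) (auto intro: fun_vs.span_base)
    moreover have "masked_row W B i = masked_row W A i + fun_scale (f i) (masked_row W A p)"
      using i B(1) by (auto simp: masked_row_def fun_scale_def fun_eq_iff)
    ultimately show "masked_row W B i \<in> fun_vs.span (masked_row W A ` V)" by simp
  qed
qed (use fin c B(2) in \<open>auto simp: masked_row_def\<close>)

text \<open>Symmetric elimination over the binary field: a diagonal pivot \<open>p\<close> splits off \<open>u u\<^sup>T\<close> for
  the row \<open>u\<close> of \<open>p\<close>; if the diagonal vanishes, an off-diagonal pivot \<open>p q\<close> splits off the rank two
  matrix \<open>u v\<^sup>T + v u\<^sup>T = u u\<^sup>T + v v\<^sup>T + (u + v) (u + v)\<^sup>T\<close>.\<close>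

lemma symmetric_bit_matrix_decomposition:
  fixes A :: "'a \<Rightarrow> 'a \<Rightarrow> bit"
  assumes "finite V" "\<And>i j. i \<in> V \<Longrightarrow> j \<in> V \<Longrightarrow> A i j = A j i"
  shows "\<exists>Ks. (\<forall>K\<in>set Ks. K \<subseteq> V) \<and> 2 * length Ks \<le> 3 * rank_on V V A \<and>
    (\<forall>i\<in>V. \<forall>j\<in>V. A i j = (\<Sum>K\<leftarrow>Ks. of_bool (i \<in> K) * of_bool (j \<in> K)))"
  using assms(2)
proof (induction "rank_on V V A" arbitrary: A rule: less_induct)
  case less
  let ?N = "\<lambda>p. {j \<in> V. A p j = 1}"
  note sym = less.prems
  have N: "(of_bool (i \<in> ?N p) :: bit) = A p i" if "i \<in> V" for i p
    using that by (cases "A p i") auto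
  consider (zero) "\<forall>i\<in>V. \<forall>j\<in>V. A i j = 0"
    | (diag) p where "p \<in> V" "A p p = 1"
    | (off) p q where "p \<in> V" "q \<in> V" "A p q = 1" "A p p = 0" "A q q = 0"
    by (metis bit_not_zero_iff)
  then show ?case
  proof cases
    case zero
    then show ?thesis by (intro exI[of _ "[]"]) auto
  next
    case diag
    \<comment> \<open>Over \<open>bit\<close> adding is subtracting: the product clears column
      \<open>p\<close>, since \<open>A p p = 1\<close>.\<close>
    define B where "B i j = A i j + A i p * A p j" for i j
    have rank: "Suc (rank_on V V B) \<le> rank_on V V A"
      using diag assms(1)
      by (intro rank_on_eliminate[of V p p V A B "\<lambda>i. A i p"]) (auto simp: B_def)
    have "\<exists>Ks. (\<forall>K\<in>set Ks. K \<subseteq> V) \<and> 2 * length Ks \<le> 3 * rank_on V V B \<and>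
      (\<forall>i\<in>V. \<forall>j\<in>V. B i j = (\<Sum>K\<leftarrow>Ks. of_bool (i \<in> K) * of_bool (j \<in> K)))"
    proof (rule less.hyps)
      show "B i j = B j i" if "i \<in> V" "j \<in> V" for i j
        using that diag(1) sym[of i j] sym[of i p] sym[of j p] by (simp only: B_def mult.commute)
    qed (use rank in simp)
    then obtain Ks where Ks: "\<forall>K\<in>set Ks. K \<subseteq> V" "2 * length Ks \<le> 3 * rank_on V V B"
      "\<forall>i\<in>V. \<forall>j\<in>V. B i j = (\<Sum>K\<leftarrow>Ks. of_bool (i \<in> K) * of_bool (j \<in> K))"
      by (elim exE conjE)
    have "A i j = (\<Sum>K\<leftarrow>?N p # Ks. of_bool (i \<in> K) * of_bool (j \<in> K))" if ij: "i \<in> V" "j \<in> V" for i j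
    proof -
      have "(\<Sum>K\<leftarrow>?N p # Ks. of_bool (i \<in> K) * of_bool (j \<in> K)) = A p i * A p j + B i j"
        unfolding list.map sum_list.Cons N[OF ij(1)] N[OF ij(2)] using Ks(3) ij by simp
      also have "\<dots> = A i j"
        using sym[OF ij(1) diag(1)] unfolding B_def
        by (cases "A p i"; cases "A p j"; cases "A i j") auto
      finally show ?thesis ..
    qed
    with Ks(1,2) rank show ?thesis by (intro exI[of _ "?N p # Ks"]) auto
  next
    case off
    \<comment> \<open>\<open>C\<close> only serves to count rank and need not be symmetric: it
      clears column \<open>q\<close> by row \<open>p\<close>. Then \<open>B\<close> clears column
      \<open>p\<close> by row \<open>q\<close>, which is the same in \<open>A\<close> and
      \<open>C\<close> because \<open>A q q = 0\<close>.\<close>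
    define C where "C i j = A i j + A i q * A p j" for i j
    define B where "B i j = A i j + A i p * A q j + A i q * A p j" for i j
    have qp: "A q p = 1" using sym[OF off(1,2)] off(3) by simp
    have "Suc (rank_on V V C) \<le> rank_on V V A"
      using off assms(1)
      by (intro rank_on_eliminate[of V p q V A C "\<lambda>i. A i q"]) (auto simp: C_def)
    moreover have "Suc (rank_on V V B) \<le> rank_on V V C"
    proof (rule rank_on_eliminate[of V q p V C B "\<lambda>i. A i p"])
      show "B i j = C i j + A i p * C q j" for i j
      proof -
        have "C q j = A q j" by (simp add: C_def off(5))
        then show ?thesis unfolding B_def C_def by (simp only: add_ac)
      qed
      show "B i p = 0" for i
        using off qp by (cases "A i p") (auto simp: B_def)
    qed (use off qp assms(1) in \<open>auto simp: C_def\<close>)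
    ultimately have rank: "rank_on V V B + 2 \<le> rank_on V V A" by simp
    have "\<exists>Ks. (\<forall>K\<in>set Ks. K \<subseteq> V) \<and> 2 * length Ks \<le> 3 * rank_on V V B \<and>
      (\<forall>i\<in>V. \<forall>j\<in>V. B i j = (\<Sum>K\<leftarrow>Ks. of_bool (i \<in> K) * of_bool (j \<in> K)))"
    proof (rule less.hyps)
      show "B i j = B j i" if "i \<in> V" "j \<in> V" for i j
        using sym[OF that] sym[OF that(1) off(1)] sym[OF that(2) off(1)]
          sym[OF that(1) off(2)] sym[OF that(2) off(2)]
        unfolding B_def by (simp only: mult.commute add_ac)
    qed (use rank in simp)
    then obtain Ks where Ks: "\<forall>K\<in>set Ks. K \<subseteq> V" "2 * length Ks \<le> 3 * rank_on V V B"
      "\<forall>i\<in>V. \<forall>j\<in>V. B i j = (\<Sum>K\<leftarrow>Ks. of_bool (i \<in> K) * of_bool (j \<in> K))"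
      by (elim exE conjE)
    \<comment> \<open>Three cliques are added against a rank drop of at least two, the source of the
      ratio 3/2. The indicator of the symmetric difference is the sum of the rows of
      \<open>p\<close> and \<open>q\<close>.\<close>
    let ?Ks = "?N p # ?N q # sym_diff (?N p) (?N q) # Ks"
    have D: "(of_bool (i \<in> sym_diff (?N p) (?N q)) :: bit) = A p i + A q i" if "i \<in> V" for i
      using that by (cases "A p i"; cases "A q i") auto
    have "A i j = (\<Sum>K\<leftarrow>?Ks. of_bool (i \<in> K) * of_bool (j \<in> K))" if ij: "i \<in> V" "j \<in> V" for i j
    proof -
      have "(\<Sum>K\<leftarrow>?Ks. of_bool (i \<in> K) * of_bool (j \<in> K)) =
        A p i * A p j + (A q i * A q j + ((A p i + A q i) * (A p j + A q j) + B i j))"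
        unfolding list.map sum_list.Cons N[OF ij(1)] N[OF ij(2)] D[OF ij(1)] D[OF ij(2)]
        using Ks(3) ij by simp
      also have "\<dots> = A i j"
        using sym[OF ij(1) off(1)] sym[OF ij(1) off(2)] unfolding B_def
        by (cases "A p i"; cases "A p j"; cases "A q i"; cases "A q j"; cases "A i j") auto
      finally show ?thesis ..
    qed
    with Ks(1,2) rank show ?thesis by (intro exI[of _ ?Ks]) auto
  qed
qed

text \<open>An optimal representing matrix is decomposed together with its diagonal, but a clique
  delta-cover sees only the off-diagonal entries, which are the adjacencies.\<close>

lemma clique_delta_cover_of_min_rank:
  assumes G: "fin_simple_graph V E"
  obtains Ks where "clique_delta_cover V E Ks" "2 * length Ks \<le> 3 * min_rank TYPE(bit) V E"
proof -
  obtain A :: "'a \<Rightarrow> 'a \<Rightarrow> bit"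
    where A: "represents V E A" "rank_on V V A = min_rank TYPE(bit) V E"
    by (rule min_rank_attained)
  have fin: "finite V" using G by (simp add: fin_simple_graph_def)
  have sym: "A i j = A j i" if "i \<in> V" "j \<in> V" for i j
    using A(1) that by (simp add: represents_def)
  have "\<exists>Ks. (\<forall>K\<in>set Ks. K \<subseteq> V) \<and> 2 * length Ks \<le> 3 * rank_on V V A \<and>
    (\<forall>i\<in>V. \<forall>j\<in>V. A i j = (\<Sum>K\<leftarrow>Ks. of_bool (i \<in> K) * of_bool (j \<in> K)))"
    using fin sym by (rule symmetric_bit_matrix_decomposition)
  then obtain Ks where Ks: "\<forall>K\<in>set Ks. K \<subseteq> V" "2 * length Ks \<le> 3 * rank_on V V A"
    "\<forall>i\<in>V. \<forall>j\<in>V. A i j = (\<Sum>K\<leftarrow>Ks. of_bool (i \<in> K) * of_bool (j \<in> K))"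
    by (elim exE conjE)
  have EA: "(of_bool ({i, j} \<in> E) :: bit) = A i j" if "i \<in> V" "j \<in> V" "i \<noteq> j" for i j
  proof -
    have "A i j = 1 \<longleftrightarrow> {i, j} \<in> E" using A(1) that by (auto simp: represents_def)
    then show ?thesis by (cases "A i j") auto
  qed
  have "clique_delta_cover V E Ks"
    unfolding clique_delta_cover_iff[OF G Ks(1)]
  proof (intro ballI impI)
    fix i j assume ij: "i \<in> V" "j \<in> V" "i \<noteq> j"
    show "(of_bool ({i, j} \<in> E) :: bit) = (\<Sum>K\<leftarrow>Ks. of_bool (i \<in> K) * of_bool (j \<in> K))"
      using EA[OF ij] bspec[OF bspec[OF Ks(3) ij(1)] ij(2)] by (rule trans)
  qed
  with Ks(2) A(2) show ?thesis using that by simp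
qed

section \<open>Bounds through the clique delta-cover number\<close>

lemma clique_delta_number_attained:
  assumes "fin_simple_graph V E"
  obtains Ks where "clique_delta_cover V E Ks" "length Ks = clique_delta_number V E"
proof -
  \<comment> \<open>Elimination on a representing matrix shows that covers exist, so
    \<open>LEAST\<close> is attained.\<close>
  have "\<exists>t Ks. clique_delta_cover V E Ks \<and> length Ks = t"
    using clique_delta_cover_of_min_rank[OF assms] by metis
  from LeastI_ex[OF this] that show ?thesis unfolding clique_delta_number_def by blast
qed

lemma clique_delta_number_le_length:
  "clique_delta_cover V E Ks \<Longrightarrow> clique_delta_number V E \<le> length Ks"
  unfolding clique_delta_number_def by (rule Least_le) blast

lemma clique_delta_number_le_min_rank:
  assumes "fin_simple_graph V E"
  shows "2 * clique_delta_number V E \<le> 3 * min_rank TYPE(bit) V E"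
proof -
  obtain Ks where "clique_delta_cover V E Ks" "2 * length Ks \<le> 3 * min_rank TYPE(bit) V E"
    by (rule clique_delta_cover_of_min_rank[OF assms])
  with clique_delta_number_le_length show ?thesis by fastforce
qed

text \<open>Indexing by positions keeps repeated cliques apart and turns a cover into a
  factorisation through \<open>length Ks\<close> rows.\<close>

lemma clique_delta_cover_adjacency:
  assumes Ks: "clique_delta_cover V E Ks" and "i \<noteq> j"
  shows "(of_bool ({i, j} \<in> E) :: bit) =
    (\<Sum>l<length Ks. of_bool (i \<in> Ks ! l) * of_bool (j \<in> Ks ! l))"
  using Ks edge_clique_delta_cover_iff[OF \<open>i \<noteq> j\<close>, of Ks]
  by (simp only: clique_delta_cover_def) (simp add: sum_list_sum_nth atLeast0LessThan)

text \<open>In any cut, the row of \<open>i\<close> is the sum of the indicator rows of the cliques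
  containing \<open>i\<close>, so the cut matrix factors through one row per clique.\<close>

lemma max_cut_rank_le_clique_delta_number:
  assumes G: "fin_simple_graph V E"
  shows "max_cut_rank V E \<le> clique_delta_number V E"
proof (rule max_cut_rank_le)
  show "finite V" using G by (simp add: fin_simple_graph_def)
  fix S assume "S \<subseteq> V"
  obtain Ks where Ks: "clique_delta_cover V E Ks" "length Ks = clique_delta_number V E"
    by (rule clique_delta_number_attained[OF G])
  have "cut_rank V E S \<le> card {..<length Ks}"
    unfolding cut_rank_def
  proof (rule rank_on_le_card[where N = "\<lambda>l j. of_bool (j \<in> Ks ! l)"])
    fix i assume "i \<in> S"
    then show "\<exists>a. \<forall>j\<in>V - S. (of_bool ({i, j} \<in> E) :: bit) =
        (\<Sum>l<length Ks. a l * of_bool (j \<in> Ks ! l))"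
      by (intro exI[of _ "\<lambda>l. of_bool (i \<in> Ks ! l)"] ballI clique_delta_cover_adjacency[OF Ks(1)]) auto
  qed simp
  with Ks(2) show "cut_rank V E S \<le> clique_delta_number V E" by simp
qed

text \<open>Each vertex is labelled by the positions of the cliques containing it; equal labels give
  equal adjacency to every third vertex.\<close>

lemma nbhd_diversity_le_power_clique_delta_number:
  assumes G: "fin_simple_graph V E"
  shows "nbhd_diversity V E \<le> 2 ^ clique_delta_number V E"
proof -
  obtain Ks where Ks: "clique_delta_cover V E Ks" "length Ks = clique_delta_number V E"
    by (rule clique_delta_number_attained[OF G])
  let ?f = "\<lambda>i. {l \<in> {..<length Ks}. i \<in> Ks ! l}"
  have fin: "finite V" using G by (simp add: fin_simple_graph_def)
  have "nbhd_diversity V E \<le> card (?f ` V)"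
  proof (rule nbhd_diversity_le_card_image[OF fin])
    fix x y assume xy: "?f x = ?f y" "x \<noteq> y"
    then have "x \<in> Ks ! l \<longleftrightarrow> y \<in> Ks ! l" if "l < length Ks" for l
      using that by (auto simp: set_eq_iff)
    then have "(of_bool ({x, z} \<in> E) :: bit) = of_bool ({y, z} \<in> E)" if "z \<noteq> x" "z \<noteq> y" for z
      using clique_delta_cover_adjacency[OF Ks(1), of x z]
        clique_delta_cover_adjacency[OF Ks(1), of y z] that
      by (auto intro!: sum.cong)
    then show "twins E x y" using xy(2) by (simp only: twins_iff of_bool_eq_iff simp_thms) blast
  qed
  also have "\<dots> \<le> card (Pow {..<length Ks})" by (intro card_mono) auto
  also have "\<dots> = 2 ^ clique_delta_number V E" using Ks(2) by (simp add: card_Pow)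
  finally show ?thesis .
qed

theorem theorem1p1:
  fixes V :: "'a set" and E :: "'a set set"
  assumes "fin_simple_graph V E" and "E \<noteq> {}"
  shows
    "(avg_cut_rank V E < real (max_cut_rank V E) \<and>
      max_cut_rank V E \<le> min_rank TYPE(bit) V E \<and>
      min_rank TYPE(bit) V E \<le> nbhd_diversity V E \<and>
      nbhd_diversity V E < 2 ^ (2 * max_cut_rank V E + 2) \<and>
      (2::real) ^ (2 * max_cut_rank V E + 2) \<le> 2 powr (8 * avg_cut_rank V E + 2)) \<and>
     (avg_cut_rank V E < real (clique_delta_number V E) \<and>
      real (clique_delta_number V E) \<le> 3 / 2 * real (min_rank TYPE(bit) V E) \<and>
      3 / 2 * real (min_rank TYPE(bit) V E) \<le> 3 / 2 * real (nbhd_diversity V E) \<and>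
      3 / 2 * real (nbhd_diversity V E) \<le> 3 / 2 * 2 ^ clique_delta_number V E) \<and>
     (nbhd_diversity V E \<le> CARD('f::{field,finite}) ^ min_rank TYPE('f) V E \<and>
      CARD('f) ^ min_rank TYPE('f) V E \<le> CARD('f) ^ nbhd_diversity V E)"
proof -
  have fin: "finite V" using assms(1) by (simp add: fin_simple_graph_def)
  note avg = avg_less_max[OF assms] and cd = max_cut_rank_le_clique_delta_number[OF assms(1)]
    and mr = min_rank_le_nbhd_diversity[OF fin, where E = E]
  \<comment> \<open>The average need not be an integer, so the last bound of the first chain uses
    \<open>powr\<close>, and the natural power is rewritten to match.\<close>
  have "(2::real) ^ (2 * max_cut_rank V E + 2) = 2 powr real (2 * max_cut_rank V E + 2)"
    by (rule powr_realpow[symmetric]) simp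
  also have "\<dots> \<le> 2 powr (8 * avg_cut_rank V E + 2)"
    using max_cut_rank_le_four_avg[OF fin, of E] by (intro powr_mono) auto
  finally have powr: "(2::real) ^ (2 * max_cut_rank V E + 2) \<le> 2 powr (8 * avg_cut_rank V E + 2)" .
  have "real (nbhd_diversity V E) \<le> real (2 ^ clique_delta_number V E)"
    using nbhd_diversity_le_power_clique_delta_number[OF assms(1)] by (simp only: of_nat_le_iff)
  moreover have "CARD('f) ^ min_rank TYPE('f) V E \<le> CARD('f) ^ nbhd_diversity V E"
    using mr by (intro power_increasing) (auto simp: Suc_le_eq)
  moreover have "avg_cut_rank V E < real (clique_delta_number V E)"
    using avg cd by linarith
  moreover have "real (2 * clique_delta_number V E) \<le> real (3 * min_rank TYPE(bit) V E)"
    using clique_delta_number_le_min_rank[OF assms(1)] by (simp only: of_nat_le_iff)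
  ultimately show ?thesis
    using avg powr mr max_cut_rank_le_min_rank[OF fin] nbhd_diversity_less[OF assms(1)]
      nbhd_diversity_le_power_min_rank[OF assms(1)]
    by auto
qed

end
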